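(* Let $\eta\in[0,2\pi)$ and let $G=(V,\mathcal{A})$ be a mixed path on $n\ge 2$ vertices equipped with its $\eta$-function $\theta$. Then $G$ is periodic, and its period is $2(n-1)$.
   Context: A mixed graph $G=(V,\mathcal{A})$ consists of a finite vertex set $V$ and arcs $\mathcal{A}\subseteq (V\times V)\setminus\{(x,x)\}$; $\mathcal{A}^{-1}=\{(y,x):(x,y)\in\mathcal{A}\}$, $\mathcal{A}^{\pm}=\mathcal{A}\cup\mathcal{A}^{-1}$. The underlying graph $G^{\pm}$ is the simple undirected graph on $V$ with $x\sim y$ iff $(x,y)\in\mathcal{A}^{\pm}$; a mixed path is a mixed graph whose underlying graph is a path. For $x\in V$, $\deg x$ is the degree of $x$ in $G^{\pm}$. For $a=(x,y)$ write $o(a)=x$, $t(a)=y$, $a^{-1}=(y,x)$. The $\eta$-function $\theta:\mathcal{A}^{\pm}\to\mathbb{R}$ is $\theta(a)=\eta$ if $a\in\mathcal{A}\setminus\mathcal{A}^{-1}$, $-\eta$ if $a\in\mathcal{A}^{-1}\setminus\mathcal{A}$, $0$ if $a\in\mathcal{A}\cap\mathcal{A}^{-1}$. Define $K\in\mathbb{C}^{V\times\mathcal{A}^{\pm}}$ by $K_{x,a}=\delta_{x,t(a)}/\sqrt{\deg x}$, the coin $C=2K^*K-I$, the shift $S_\theta\in\mathbb{C}^{\mathcal{A}^{\pm}\times\mathcal{A}^{\pm}}$ by $(S_\theta)_{a,b}=e^{\theta(b)i}\delta_{a,b^{-1}}$, and the time evolution matrix $U_\theta=S_\theta C$. $G$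 is periodic if $U_\theta^\tau=I$ for some $\tau\in\mathbb{N}$, and then its period is the least such $\tau$. *)

theory Defs
  imports Complex_Main
begin

section \<open>Mixed graphs\<close>

definition mixed_graph :: "'v set \<Rightarrow> ('v \<times> 'v) set \<Rightarrow> bool" where
  "mixed_graph V A \<longleftrightarrow> finite V \<and> A \<subseteq> V \<times> V - Id"

text \<open>The set \<open>A \<union> A\<inverse>\<close> is at the same time the adjacency relation of the underlying simple
  graph and the index set of the matrices of the quantum walk.\<close>

definition arcs_pm :: "('v \<times> 'v) set \<Rightarrow> ('v \<times> 'v) set" where
  "arcs_pm A = A \<union> A\<inverse>"

definition degree :: "('v \<times> 'v) set \<Rightarrow> 'v \<Rightarrow> nat" where
  "degree A x = card {y. (x, y) \<in> arcs_pm A}"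

text \<open>A simple graph, given by its vertex set and its symmetric adjacency relation, is a path if its
  vertices can be listed without repetition so that precisely the consecutive ones are adjacent.\<close>

definition path_graph :: "'v set \<Rightarrow> ('v \<times> 'v) set \<Rightarrow> bool" where
  "path_graph V E \<longleftrightarrow> (\<exists>xs. xs \<noteq> [] \<and> distinct xs \<and> set xs = V \<and>
     E = {(xs ! i, xs ! j) | i j. i < length xs \<and> j < length xs \<and> (j = Suc i \<or> i = Suc j)})"

definition mixed_path :: "'v set \<Rightarrow> ('v \<times> 'v) set \<Rightarrow> bool" where
  "mixed_path V A \<longleftrightarrow> mixed_graph V A \<and> path_graph V (arcs_pm A)"

definition eta_function :: "real \<Rightarrow> ('v \<times> 'v) set \<Rightarrow> 'v \<times> 'v \<Rightarrow> real" where
  "eta_function \<eta> A a =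
     (if a \<in> A - A\<inverse> then \<eta> else if a \<in> A\<inverse> - A then - \<eta> else 0)"


section \<open>Complex matrices indexed by finite sets\<close>

text \<open>Matrices are functions of their two indices. Only the entries at indices in the intended
  finite index sets are meaningful, so products are given the set over which they sum, and
  equations between matrices are stated entrywise on the index sets.\<close>

type_synonym ('i, 'j) cmatrix = "'i \<Rightarrow> 'j \<Rightarrow> complex"

definition mat_id :: "('i, 'i) cmatrix" where
  "mat_id a b = (if a = b then 1 else 0)"

definition mat_mult :: "'j set \<Rightarrow> ('i, 'j) cmatrix \<Rightarrow> ('j, 'k) cmatrix \<Rightarrow> ('i, 'k) cmatrix" where
  "mat_mult J M N a b = (\<Sum>c\<in>J. M a c * N c b)"

definition mat_adjoint :: "('i, 'j) cmatrix \<Rightarrow> ('j, 'i) cmatrix" where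
  "mat_adjoint M a b = cnj (M b a)"

primrec mat_pow :: "'i set \<Rightarrow> ('i, 'i) cmatrix \<Rightarrow> nat \<Rightarrow> ('i, 'i) cmatrix" where
  "mat_pow J M 0 = mat_id"
| "mat_pow J M (Suc k) = mat_mult J M (mat_pow J M k)"


section \<open>The quantum walk on a mixed graph\<close>

text \<open>For an arc \<open>a = (x, y)\<close>, the origin is \<open>fst a\<close>, the terminus is \<open>snd a\<close> and the inverse arc is
  \<open>prod.swap a\<close>.\<close>

definition boundary_mat :: "('v \<times> 'v) set \<Rightarrow> ('v, 'v \<times> 'v) cmatrix" where
  "boundary_mat A x a = (if x = snd a then 1 else 0) / complex_of_real (sqrt (real (degree A x)))"

definition coin_mat :: "'v set \<Rightarrow> ('v \<times> 'v) set \<Rightarrow> ('v \<times> 'v, 'v \<times> 'v) cmatrix" where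
  "coin_mat V A a b =
     2 * mat_mult V (mat_adjoint (boundary_mat A)) (boundary_mat A) a b - mat_id a b"

definition shift_mat :: "('v \<times> 'v \<Rightarrow> real) \<Rightarrow> ('v \<times> 'v, 'v \<times> 'v) cmatrix" where
  "shift_mat \<theta> a b = exp (complex_of_real (\<theta> b) * \<i>) * (if a = prod.swap b then 1 else 0)"

definition time_evolution ::
  "'v set \<Rightarrow> ('v \<times> 'v) set \<Rightarrow> ('v \<times> 'v \<Rightarrow> real) \<Rightarrow> ('v \<times> 'v, 'v \<times> 'v) cmatrix" where
  "time_evolution V A \<theta> = mat_mult (arcs_pm A) (shift_mat \<theta>) (coin_mat V A)"

definition returns_at :: "'v set \<Rightarrow> ('v \<times> 'v) set \<Rightarrow> ('v \<times> 'v \<Rightarrow> real) \<Rightarrow> nat \<Rightarrow> bool" where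
  "returns_at V A \<theta> \<tau> \<longleftrightarrow>
     (\<forall>a\<in>arcs_pm A. \<forall>b\<in>arcs_pm A.
        mat_pow (arcs_pm A) (time_evolution V A \<theta>) \<tau> a b = mat_id a b)"

text \<open>The exponent \<open>0\<close> is excluded, since the zeroth power is always the identity.\<close>

definition periodic :: "'v set \<Rightarrow> ('v \<times> 'v) set \<Rightarrow> ('v \<times> 'v \<Rightarrow> real) \<Rightarrow> bool" where
  "periodic V A \<theta> \<longleftrightarrow> (\<exists>\<tau>>0. returns_at V A \<theta> \<tau>)"

definition period :: "'v set \<Rightarrow> ('v \<times> 'v) set \<Rightarrow> ('v \<times> 'v \<Rightarrow> real) \<Rightarrow> nat" where
  "period V A \<theta> = (LEAST \<tau>. \<tau> > 0 \<and> returns_at V A \<theta> \<tau>)"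

end

(* On a path the coin is a permutation matrix: it sends an arc into y to the other arc into y, or
   fixes it if y is an endpoint.  Hence the time evolution maps each arc, up to a phase, to the next
   arc of the closed walk that runs along the path from one end to the other and back.  This walk
   uses each of the 2(n-1) arcs exactly once.  As a path has no cycles, theta is the difference of
   a potential on the vertices, so the phases cancel around the closed walk. *)

theory Submission
  imports Defs
begin

lemma coin_mat_entry:
  assumes "finite V" and "snd b \<in> V"
  shows "coin_mat V A a b =
    (if snd a = snd b then 2 / of_nat (degree A (snd b)) else 0) - mat_id a b"
proof -
  have "mat_mult V (mat_adjoint (boundary_mat A)) (boundary_mat A) a b =
      (\<Sum>x\<in>V. if x = snd b then
        (if snd a = snd b then 1 / of_nat (degree A (snd b)) else 0) else 0)"
    unfolding mat_mult_def mat_adjoint_def boundary_mat_def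
    by (rule sum.cong) (auto simp flip: of_real_mult)
  also have "\<dots> = (if snd a = snd b then 1 / of_nat (degree A (snd b)) else 0)"
    using assms by simp
  finally show ?thesis
    by (simp add: coin_mat_def)
qed

text \<open>Row \<open>a\<close> of the shift has a single non-zero entry, in column
  \<open>prod.swap a\<close>, so the product with the coin collapses to one term.\<close>

lemma time_evolution_entry:
  assumes "finite (arcs_pm A)" and "a \<in> arcs_pm A"
  shows "time_evolution V A \<theta> a b =
    exp (complex_of_real (\<theta> (prod.swap a)) * \<i>) * coin_mat V A (prod.swap a) b"
proof -
  have swap: "prod.swap a \<in> arcs_pm A"
    using assms(2) by (cases a) (auto simp: arcs_pm_def)
  have "time_evolution V A \<theta> a b = (\<Sum>c\<in>arcs_pm A. if c = prod.swap a then
      exp (complex_of_real (\<theta> c) * \<i>) * coin_mat V A c b else 0)"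
    unfolding time_evolution_def mat_mult_def shift_mat_def
    by (rule sum.cong) auto
  then show ?thesis
    using assms(1) swap by simp
qed

lemma eta_function_swap: "eta_function \<eta> A (prod.swap a) = - eta_function \<eta> A a"
  by (cases a) (auto simp: eta_function_def)

text \<open>The hypothesis \<open>nbrs\<close> covers both kinds of vertex. At an inner one the coin
  entries are 2/2 - 1 = 0 for staying on the arc and 2/2 = 1 for switching, so the walk passes
  through; at an endpoint the only entry is 2/1 - 1 = 1, so it is reflected.\<close>

lemma time_evolution_walk:
  assumes "finite V" and "arcs_pm A \<subseteq> V \<times> V"
    and nbrs: "{y. (w (Suc k), y) \<in> arcs_pm A} = {w k, w (Suc (Suc k))}"
    and skew: "\<And>a. \<theta> (prod.swap a) = - \<theta> a"
    and a: "a \<in> arcs_pm A"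
  shows "time_evolution V A \<theta> a (w k, w (Suc k)) =
    (if a = (w (Suc k), w (Suc (Suc k))) then exp (- complex_of_real (\<theta> a) * \<i>) else 0)"
proof -
  have fin: "finite (arcs_pm A)"
    using assms(1,2) by (meson finite_SigmaI finite_subset)
  have "(w (Suc k), w k) \<in> arcs_pm A"
    using nbrs by blast
  then have inV: "w (Suc k) \<in> V"
    using assms(2) by blast
  \<comment> \<open>The two neighbours coincide exactly where the walk turns around.\<close>
  have deg: "degree A (w (Suc k)) = (if w k = w (Suc (Suc k)) then 1 else 2)"
    unfolding degree_def nbrs by simp
  have succ: "snd a = w k \<or> snd a = w (Suc (Suc k))" if "fst a = w (Suc k)"
    using a that nbrs by (cases a) auto
  have "coin_mat V A (prod.swap a) (w k, w (Suc k)) =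
      (if a = (w (Suc k), w (Suc (Suc k))) then 1 else 0)"
    using succ by (cases a) (auto simp: coin_mat_entry[OF assms(1)] inV deg mat_id_def)
  then show ?thesis
    by (simp add: time_evolution_entry[OF fin a] skew)
qed

text \<open>Each step contributes the phase of minus \<open>\<theta>\<close> on the arc it enters,
  and these differences of \<open>p\<close> telescope. Here \<open>p\<close> is indexed by time
  along the walk, not by vertices.\<close>

lemma mat_pow_walk:
  assumes "finite V" and "arcs_pm A \<subseteq> V \<times> V"
    and nbrs: "\<And>k. {y. (w (Suc k), y) \<in> arcs_pm A} = {w k, w (Suc (Suc k))}"
    and skew: "\<And>a. \<theta> (prod.swap a) = - \<theta> a"
    and pot: "\<And>k. \<theta> (w k, w (Suc k)) = p (Suc k) - p k"
    and a: "a \<in> arcs_pm A"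
  shows "mat_pow (arcs_pm A) (time_evolution V A \<theta>) t a (w k, w (Suc k)) =
    (if a = (w (k + t), w (Suc (k + t)))
     then exp (complex_of_real (p (Suc k) - p (Suc (k + t))) * \<i>) else 0)"
  using a
proof (induction t arbitrary: a)
  case 0
  then show ?case
    by (simp add: mat_id_def)
next
  case (Suc t)
  let ?e = "\<lambda>k. (w k, w (Suc k))"
  let ?U = "time_evolution V A \<theta>"
  have fin: "finite (arcs_pm A)"
    using assms(1,2) by (meson finite_SigmaI finite_subset)
  have arc: "?e j \<in> arcs_pm A" for j
    using nbrs[of j] by (auto simp: arcs_pm_def)
  have "mat_pow (arcs_pm A) ?U (Suc t) a (?e k) =
      (\<Sum>c\<in>arcs_pm A. if c = ?e (k + t)
        then ?U a c * exp (complex_of_real (p (Suc k) - p (Suc (k + t))) * \<i>) else 0)"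
    by (simp add: mat_mult_def Suc.IH if_distrib cong: sum.cong if_cong)
  also have "\<dots> = ?U a (?e (k + t)) * exp (complex_of_real (p (Suc k) - p (Suc (k + t))) * \<i>)"
    using fin arc by simp
  finally show ?case
    by (simp add: time_evolution_walk[where w = w and k = "k + t" and \<theta> = \<theta>, OF assms(1,2) nbrs skew Suc.prems] pot
        flip: exp_add) (simp add: algebra_simps)
qed

lemma returns_at_walk_iff:
  assumes "finite V" and "arcs_pm A \<subseteq> V \<times> V"
    and nbrs: "\<And>k. {y. (w (Suc k), y) \<in> arcs_pm A} = {w k, w (Suc (Suc k))}"
    and skew: "\<And>a. \<theta> (prod.swap a) = - \<theta> a"
    and pot: "\<And>k. \<theta> (w k, w (Suc k)) = p (Suc k) - p k"
    and arcs: "arcs_pm A = range (\<lambda>k. (w k, w (Suc k)))"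
    and inj: "\<And>k l. w k = w l \<Longrightarrow> w (Suc k) = w (Suc l) \<Longrightarrow> k mod N = l mod N"
    and per: "\<And>k l. k mod N = l mod N \<Longrightarrow> w k = w l \<and> p k = p l"
  shows "returns_at V A \<theta> t \<longleftrightarrow> N dvd t"
proof
  have arc: "(w k, w (Suc k)) \<in> arcs_pm A" for k
    using arcs by auto
  note pow = mat_pow_walk[where w = w and p = p and \<theta> = \<theta>, OF assms(1,2) nbrs skew pot]
  {
    assume "returns_at V A \<theta> t"
    \<comment> \<open>One diagonal entry suffices: it vanishes unless the walk is back on its first
      arc after \<open>t\<close> steps.\<close>
    then have "mat_pow (arcs_pm A) (time_evolution V A \<theta>) t (w 0, w 1) (w 0, w (Suc 0)) = 1"
      using arc[of 0] by (simp add: returns_at_def mat_id_def)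
    moreover have "(w 0, w 1) \<in> arcs_pm A"
      using arc[of 0] by simp
    ultimately have "w 0 = w t" "w (Suc 0) = w (Suc t)"
      by (simp_all add: pow split: if_splits)
    from inj[OF this] show "N dvd t"
      by (simp add: mod_eq_0_iff_dvd)
  next
    assume "N dvd t"
    then have "(k + t) mod N = k mod N" for k
      by (auto simp: dvd_def)
    then have "w (k + t) = w k" "p (k + t) = p k" for k
      using per by blast+
    from this this[of "Suc k" for k]
    have "w (k + t) = w k" "w (Suc (k + t)) = w (Suc k)" "p (Suc (k + t)) = p (Suc k)" for k
      by simp_all
    then show "returns_at V A \<theta> t"
      \<comment> \<open>Only the range of the column index is rewritten, since \<open>pow\<close>
        needs columns in the form of walk arcs but allows any row.\<close>
      unfolding returns_at_def by (subst (2) arcs) (auto simp: pow mat_id_def)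
  }
qed

text \<open>The triangle wave of period \<open>2 * m\<close>: the position at time \<open>k\<close>
  of a point running 0, 1, ..., m and back.\<close>

definition bounce :: "nat \<Rightarrow> nat \<Rightarrow> nat" where
  "bounce m k = (let r = k mod (2 * m) in if r \<le> m then r else 2 * m - r)"

lemma bounce_cong: "k mod (2 * m) = l mod (2 * m) \<Longrightarrow> bounce m k = bounce m l"
  by (simp add: bounce_def)

lemma bounce_le: "bounce m k \<le> m"
  by (auto simp: bounce_def Let_def)

lemma bounce_neighbours:
  assumes "m > 0"
  shows "{j. j \<le> m \<and> (j = Suc (bounce m (Suc k)) \<or> bounce m (Suc k) = Suc j)} =
    {bounce m k, bounce m (Suc (Suc k))}"
proof -
  define r where "r = k mod (2 * m)"
  have "r < 2 * m"
    using assms by (simp add: r_def)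
  then have "j \<le> m \<and> (j = Suc (bounce m (Suc k)) \<or> bounce m (Suc k) = Suc j) \<longleftrightarrow>
      j = bounce m k \<or> j = bounce m (Suc (Suc k))" for j
    \<comment> \<open>The residues of the next two times are successors of \<open>r\<close> unless
      they wrap to 0. The cases settle the wrapping and the side of \<open>m\<close>, leaving linear
      arithmetic.\<close>
    unfolding bounce_def Let_def mod_Suc r_def[symmetric] using assms
    by (cases "Suc r = 2 * m"; cases "Suc (Suc r) = 2 * m"; cases "r \<le> m";
        cases "Suc r \<le> m"; cases "Suc (Suc r) \<le> m"; simp; arith)
  then show ?thesis
    by blast
qed

lemma bounce_Suc_cases:
  assumes "m > 0"
  shows "bounce m (Suc k) = Suc (bounce m k) \<or> bounce m k = Suc (bounce m (Suc k))"
  using bounce_neighbours[OF assms, of k] by blast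

text \<open>An inner position occurs twice per period, once in each direction; the next position
  reveals the direction and hence the time.\<close>

lemma bounce_arc_inj:
  assumes "m > 0" and "bounce m k = bounce m l" and "bounce m (Suc k) = bounce m (Suc l)"
  shows "k mod (2 * m) = l mod (2 * m)"
proof -
  have "k mod (2 * m) < 2 * m" "l mod (2 * m) < 2 * m"
    using assms(1) by simp_all
  then show ?thesis
    using assms(2,3) by (auto simp: bounce_def Let_def mod_Suc split: if_splits)
qed

lemma bounce_arc_surj:
  assumes "i \<le> m" and "j \<le> m" and "j = Suc i \<or> i = Suc j"
  shows "\<exists>k. bounce m k = i \<and> bounce m (Suc k) = j"
proof (cases "j = Suc i")
  case True
  then show ?thesis
    using assms by (intro exI[of _ i]) (auto simp: bounce_def Let_def)
next
  case False
  \<comment> \<open>A descending arc is used on the way back, which reaches \<open>i\<close> at time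
    \<open>2 * m - i\<close>.\<close>
  then have "bounce m (2 * m - i) = i" "bounce m (Suc (2 * m - i)) = j"
    using assms by (auto simp: bounce_def Let_def mod_Suc)
  then show ?thesis
    by blast
qed

lemma mixed_path_returns_at_iff:
  assumes "mixed_path V A" and "card V \<ge> 2"
  shows "returns_at V A (eta_function \<eta> A) t \<longleftrightarrow> 2 * (card V - 1) dvd t"
proof -
  from assms(1) obtain xs where xs: "distinct xs" "set xs = V"
    and E: "arcs_pm A =
      {(xs ! i, xs ! j) | i j. i < length xs \<and> j < length xs \<and> (j = Suc i \<or> i = Suc j)}"
    by (auto simp: mixed_path_def path_graph_def)
  define m where "m = card V - 1"
  have m: "m > 0" and len: "length xs = Suc m"
    using assms(2) distinct_card[OF xs(1)] xs(2) by (simp_all add: m_def)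
  define w where "w k = xs ! bounce m k" for k
  let ?\<theta> = "eta_function \<eta> A"
  \<comment> \<open>The potential: \<open>\<theta>\<close> summed along the path from its first
    vertex up to vertex \<open>i\<close>.\<close>
  define P where "P i = (\<Sum>j<i. ?\<theta> (xs ! j, xs ! Suc j))" for i
  have nth_eq: "xs ! i = xs ! j \<longleftrightarrow> i = j" if "i \<le> m" "j \<le> m" for i j
    using that xs(1) len by (simp add: nth_eq_iff_index_eq)
  have arcs: "arcs_pm A = range (\<lambda>k. (w k, w (Suc k)))"
  proof (intro equalityI subsetI)
    fix a assume "a \<in> arcs_pm A"
    then obtain i j where a: "a = (xs ! i, xs ! j)"
      and ij: "i \<le> m" "j \<le> m" "j = Suc i \<or> i = Suc j"
      unfolding E len by auto
    obtain k where "bounce m k = i" "bounce m (Suc k) = j"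
      using bounce_arc_surj[OF ij] by blast
    then show "a \<in> range (\<lambda>k. (w k, w (Suc k)))"
      by (intro range_eqI[of _ _ k]) (simp add: a w_def)
  next
    fix a assume "a \<in> range (\<lambda>k. (w k, w (Suc k)))"
    then obtain k where a: "a = (xs ! bounce m k, xs ! bounce m (Suc k))"
      unfolding w_def by blast
    have "bounce m k < length xs" "bounce m (Suc k) < length xs"
      using bounce_le[of m] by (simp_all add: len less_Suc_eq_le)
    then show "a \<in> arcs_pm A"
      unfolding E a using bounce_Suc_cases[OF m, of k] by blast
  qed
  have nbrs: "{y. (w (Suc k), y) \<in> arcs_pm A} = {w k, w (Suc (Suc k))}" for k
  proof -
    have "(w (Suc k), y) \<in> arcs_pm A \<longleftrightarrow>
        (\<exists>j\<le>m. y = xs ! j \<and> (j = Suc (bounce m (Suc k)) \<or> bounce m (Suc k) = Suc j))" for y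
      unfolding E len w_def using nth_eq bounce_le[of m "Suc k"]
      by (simp add: less_Suc_eq_le) metis
    then have "{y. (w (Suc k), y) \<in> arcs_pm A} =
        (!) xs ` {j. j \<le> m \<and> (j = Suc (bounce m (Suc k)) \<or> bounce m (Suc k) = Suc j)}"
      by blast
    then show ?thesis
      by (simp add: bounce_neighbours[OF m] w_def)
  qed
  have skew: "?\<theta> (prod.swap a) = - ?\<theta> a" for a
    by (rule eta_function_swap)
  \<comment> \<open>Ascending steps add the next summand of \<open>P\<close>; descending ones run
    through the reversed arc, where \<open>skew\<close> supplies the sign.\<close>
  have pot: "?\<theta> (w k, w (Suc k)) = P (bounce m (Suc k)) - P (bounce m k)" for k
    using bounce_Suc_cases[OF m, of k] skew[of "(w (Suc k), w k)"]
    by (auto simp: P_def w_def)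
  have sub: "arcs_pm A \<subseteq> V \<times> V" and fin: "finite V"
    using assms(1) by (auto simp: mixed_path_def mixed_graph_def arcs_pm_def)
  have "returns_at V A ?\<theta> t \<longleftrightarrow> 2 * m dvd t"
  proof (rule returns_at_walk_iff[where w = w and p = "\<lambda>k. P (bounce m k)"])
    show "k mod (2 * m) = l mod (2 * m)" if "w k = w l" "w (Suc k) = w (Suc l)" for k l
    proof (rule bounce_arc_inj[OF m])
      show "bounce m k = bounce m l" "bounce m (Suc k) = bounce m (Suc l)"
        using that by (simp_all add: w_def nth_eq bounce_le)
    qed
    show "w k = w l \<and> P (bounce m k) = P (bounce m l)" if "k mod (2 * m) = l mod (2 * m)" for k l
      using bounce_cong[OF that] by (simp add: w_def)
  qed (fact fin sub nbrs skew pot arcs)+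
  then show ?thesis
    by (simp add: m_def)
qed

theorem theorem1p2:
  fixes \<eta> :: real and V :: "'v set" and A :: "('v \<times> 'v) set"
    and \<theta> :: "'v \<times> 'v \<Rightarrow> real" and n :: nat
  assumes "0 \<le> \<eta>" and "\<eta> < 2 * pi"
    and "mixed_path V A"
    and "card V = n" and "n \<ge> 2"
    and "\<theta> = eta_function \<eta> A"
  shows "periodic V A \<theta> \<and> period V A \<theta> = 2 * (n - 1)"
proof -
  have iff: "returns_at V A \<theta> t \<longleftrightarrow> 2 * (n - 1) dvd t" for t
    using mixed_path_returns_at_iff[OF assms(3)] assms(4-6) by simp
  have pos: "2 * (n - 1) > 0"
    using assms(5) by simp
  have "periodic V A \<theta>"
    unfolding periodic_def iff by (intro exI[of _ "2 * (n - 1)"] conjI pos dvd_refl)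
  moreover have "period V A \<theta> = 2 * (n - 1)"
    unfolding period_def iff using pos by (intro Least_equality conjI dvd_refl) (simp_all add: dvd_imp_le)
  ultimately show ?thesis ..
qed

end
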